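(* Let $X,X',Y,Y'$ be compact Hausdorff topological spaces, and let $b:X\times Y\to\mathbb R$ and $c:X'\times Y'\to\mathbb R$ be two continuous fully-reduced kernels. Then the following statements are equivalent: (i) there exists a (max,+)-isomorphism $J:\operatorname{Rg}(B)\to\operatorname{Rg}(C)$; (ii) there exists a (max,+)-isomorphism $J^\circ:\operatorname{Rg}(B^\circ)\to\operatorname{Rg}(C^\circ)$; (iii) there exist two homeomorphisms $\tau:X'\to X$ and $\sigma:Y'\to Y$, and two continuous functions $\psi:X'\to\mathbb R$ and $\varphi:Y'\to\mathbb R$ such that for all $x'\in X'$, $y'\in Y'$, $$c(x',y')=\psi(x')+b(\tau(x'),\sigma(y'))+\varphi(y');$$ (iv) all (max,+)-isomorphisms $J:\operatorname{Rg}(B)\to\operatorname{Rg}(C)$ are of the form $Jf=\psi+f\circ\tau$ for some $\psi:X'\to\mathbb R$ and some bijective $\tau:X'\to X$, and there exists one such $J$; (v) all (max,+)-isomorphisms $J^\circ:\operatorname{Rg}(B^\circ)\to\operatorname{Rg}(C^\circ)$ are of the form $J^\circ h=\varphi+h\circ\sigma$ for some $\varphi:Y'\to\mathbb R$ and some bijective $\sigma:Y'\to Y$, and there exists one such $J^\circ$.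
   Context: All spaces are nonempty; $\overline{\mathbb R}=[-\infty,+\infty]$. For a kernel $b:X\times Y\to\overline{\mathbb R}$, define $\bar B:\overline{\mathbb R}^Y\to\overline{\mathbb R}^X$, $\bar Bf(x)=\sup_{y\in Y}[b(x,y)-f(y)]$, and $\bar B^\circ:\overline{\mathbb R}^X\to\overline{\mathbb R}^Y$, $\bar B^\circ h(y)=\sup_{x\in X}[b(x,y)-h(x)]$ (with $-\infty$ absorbing). $\operatorname{Rg}(B)\subset\overline{\mathbb R}^X$ and $\operatorname{Rg}(B^\circ)\subset\overline{\mathbb R}^Y$ denote the ranges of $\bar B$ and $\bar B^\circ$; $\operatorname{Rg}(C)\subset\overline{\mathbb R}^{X'}$ and $\operatorname{Rg}(C^\circ)\subset\overline{\mathbb R}^{Y'}$ are defined in the same way from $c$. An element $f$ of a set $\mathcal G$ of functions is sup-irreducible (in $\mathcal G$) if for all $g,h\in\mathcal G$, $f=\sup(g,h)$ implies $f=g$ or $f=h$. A kernel $b:X\times Y\to\mathbb R$ is fully-reduced if for all $x\in X$ and $y\in Y$ the function $b(\cdot,y)$ is sup-irreducible in $\operatorname{Rg}(B)$ and $b(x,\cdot)$ is sup-irreducible in $\operatorname{Rg}(B^\circ)$, and if for all $x_0,x_1\in X$, $y_0,y_1\in Y$, $\lambda\in\mathbb R$: $b(\cdot,y_0)=b(\cdot,y_1)+\lambda$ implies $y_0=y_1$, and $b(x_0,\cdot)=b(x_1,\cdot)+\lambda$ implies $x_0=x_1$. A (max,+)-isomorphism is a bijection commuting with pairwise suprema and with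 the addition of real scalars ($J(f+\lambda)=Jf+\lambda$). *)

theory Defs
  imports "HOL-Analysis.Analysis"
begin

(* The kernels are real-valued, so that the difference below is never of the form
   \<infinity> - \<infinity>: no convention on the sum of opposite infinities is involved. *)
definition kernel_op :: "('x \<Rightarrow> 'y \<Rightarrow> real) \<Rightarrow> ('y \<Rightarrow> ereal) \<Rightarrow> 'x \<Rightarrow> ereal" where
  "kernel_op b f = (\<lambda>x. SUP y. ereal (b x y) - f y)"

definition kernel_dual_op :: "('x \<Rightarrow> 'y \<Rightarrow> real) \<Rightarrow> ('x \<Rightarrow> ereal) \<Rightarrow> 'y \<Rightarrow> ereal" where
  "kernel_dual_op b h = (\<lambda>y. SUP x. ereal (b x y) - h x)"

definition Rg :: "('x \<Rightarrow> 'y \<Rightarrow> real) \<Rightarrow> ('x \<Rightarrow> ereal) set" where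
  "Rg b = range (kernel_op b)"

definition Rg_dual :: "('x \<Rightarrow> 'y \<Rightarrow> real) \<Rightarrow> ('y \<Rightarrow> ereal) set" where
  "Rg_dual b = range (kernel_dual_op b)"

definition sup_irreducible_in :: "('x \<Rightarrow> ereal) set \<Rightarrow> ('x \<Rightarrow> ereal) \<Rightarrow> bool" where
  "sup_irreducible_in G f \<longleftrightarrow>
     f \<in> G \<and> (\<forall>g\<in>G. \<forall>h\<in>G. f = sup g h \<longrightarrow> f = g \<or> f = h)"

definition fully_reduced :: "('x \<Rightarrow> 'y \<Rightarrow> real) \<Rightarrow> bool" where
  "fully_reduced b \<longleftrightarrow>
     (\<forall>y. sup_irreducible_in (Rg b) (\<lambda>x. ereal (b x y))) \<and>
     (\<forall>x. sup_irreducible_in (Rg_dual b) (\<lambda>y. ereal (b x y))) \<and>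
     (\<forall>y0 y1 (r::real). (\<lambda>x. b x y0) = (\<lambda>x. b x y1 + r) \<longrightarrow> y0 = y1) \<and>
     (\<forall>x0 x1 (r::real). (\<lambda>y. b x0 y) = (\<lambda>y. b x1 y + r) \<longrightarrow> x0 = x1)"

(* A map G \<rightarrow> H is represented by a total function, of which only the values on G matter. *)
definition maxplus_isomorphism ::
    "('x \<Rightarrow> ereal) set \<Rightarrow> ('z \<Rightarrow> ereal) set \<Rightarrow> (('x \<Rightarrow> ereal) \<Rightarrow> 'z \<Rightarrow> ereal) \<Rightarrow> bool" where
  "maxplus_isomorphism G H J \<longleftrightarrow>
     bij_betw J G H \<and>
     (\<forall>f\<in>G. \<forall>g\<in>G. J (sup f g) = sup (J f) (J g)) \<and>
     (\<forall>f\<in>G. \<forall>r::real. J (\<lambda>x. f x + ereal r) = (\<lambda>z. J f z + ereal r))"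

definition weighted_composition_on ::
    "('x \<Rightarrow> ereal) set \<Rightarrow> (('x \<Rightarrow> ereal) \<Rightarrow> 'z \<Rightarrow> ereal) \<Rightarrow> bool" where
  "weighted_composition_on G J \<longleftrightarrow>
     (\<exists>(\<psi> :: 'z \<Rightarrow> real) (\<tau> :: 'z \<Rightarrow> 'x).
        bij \<tau> \<and> (\<forall>f\<in>G. J f = (\<lambda>z. ereal (\<psi> z) + f (\<tau> z))))"

end

theory Submission
  imports Defs
begin

text \<open>On compact spaces the sup-irreducible elements of $\mathrm{Rg}(B)$ other than
  $\pm\infty$ are exactly the $b(\cdot,y)+\lambda$, so an isomorphism $J$ permutes them; this
  gives $\sigma$ and $\varphi$. The same argument applied to $C^\circ J B$, an isomorphism of the
  dual ranges, gives $\tau$ and $\psi$. As $f(x) \le \lambda$ iff $f \le B(b(x,\cdot))+\lambda$,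
  the value of $f$ at $x$ is expressed by the order, and $J B(b(\tau(x'),\cdot)) =
  C(c(x',\cdot)) + \psi(x')$ forces $Jf = \psi + f \circ \tau$. Evaluating this at the
  $b(\cdot,\sigma(y'))$ yields the identity between the kernels.\<close>

section \<open>The Galois connection of a kernel\<close>

lemma kernel_dual_op_eq: "kernel_dual_op b = kernel_op (\<lambda>y x. b x y)"
  by (simp add: fun_eq_iff kernel_dual_op_def kernel_op_def)

lemma Rg_dual_eq: "Rg_dual b = Rg (\<lambda>y x. b x y)"
  by (simp add: Rg_dual_def Rg_def kernel_dual_op_eq)

lemma fully_reduced_transpose: "fully_reduced b \<Longrightarrow> fully_reduced (\<lambda>y x. b x y)"
  by (simp add: fully_reduced_def Rg_dual_eq)

text \<open>For finite \<open>u\<close> and \<open>v\<close> both sides say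
  \<open>r \<le> u + v\<close>. As \<open>r\<close> is real, they also agree when \<open>u\<close>
  or \<open>v\<close> is infinite, and this symmetry yields the Galois connection.\<close>

lemma ereal_minus_le_swap: "ereal r - u \<le> v \<longleftrightarrow> ereal r - v \<le> u"
  by (cases u; cases v) auto

lemma kernel_op_galois: "kernel_op b g \<le> f \<longleftrightarrow> kernel_dual_op b f \<le> g"
  by (auto simp: le_fun_def kernel_op_def kernel_dual_op_def SUP_le_iff ereal_minus_le_swap)

lemma kernel_op_antimono: "g \<le> g' \<Longrightarrow> kernel_op b g' \<le> kernel_op b g"
  unfolding le_fun_def kernel_op_def by (intro allI SUP_mono' ereal_minus_mono) auto

lemma kernel_dual_op_antimono: "f \<le> f' \<Longrightarrow> kernel_dual_op b f' \<le> kernel_dual_op b f"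
  by (simp add: kernel_dual_op_eq kernel_op_antimono)

text \<open>The Galois connection gives one inequality for every \<open>f\<close>. If
  \<open>f = kernel_op b g\<close>, it also gives \<open>kernel_dual_op b f \<le> g\<close>, and
  antitonicity yields the other one.\<close>

lemma kernel_op_dual_inverse: "f \<in> Rg b \<Longrightarrow> kernel_op b (kernel_dual_op b f) = f"
  unfolding Rg_def by (metis antisym imageE kernel_op_antimono kernel_op_galois order_refl)

lemma kernel_dual_op_inverse: "g \<in> Rg_dual b \<Longrightarrow> kernel_dual_op b (kernel_op b g) = g"
  using kernel_op_dual_inverse[of g "\<lambda>y x. b x y"] by (simp add: Rg_dual_eq kernel_dual_op_eq)

lemma kernel_op_in_Rg: "kernel_op b g \<in> Rg b"
  by (simp add: Rg_def)

lemma kernel_dual_op_in_Rg_dual: "kernel_dual_op b f \<in> Rg_dual b"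
  by (simp add: Rg_dual_def)

lemma ereal_SUP_add_real:
  fixes f :: "'a \<Rightarrow> ereal"
  shows "(SUP i. f i) + ereal r = (SUP i. f i + ereal r)"
  by (subst SUP_ereal_add_left) auto

lemma kernel_op_add_real: "kernel_op b (\<lambda>y. g y + ereal r) = (\<lambda>x. kernel_op b g x + ereal (- r))"
proof -
  have "ereal u - (v + ereal r) = (ereal u - v) + ereal (- r)" for u v
    by (cases v) auto
  then show ?thesis
    unfolding kernel_op_def ereal_SUP_add_real by simp
qed

lemma Rg_add_real:
  assumes "f \<in> Rg b"
  shows "(\<lambda>x. f x + ereal r) \<in> Rg b"
proof -
  obtain g where "f = kernel_op b g" using assms by (auto simp: Rg_def)
  then have "(\<lambda>x. f x + ereal r) = kernel_op b (\<lambda>y. g y + ereal (- r))"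
    by (simp only: kernel_op_add_real) simp
  then show ?thesis by (simp add: kernel_op_in_Rg)
qed

text \<open>Subtraction from a real turns minima into maxima. Hence the range is closed under
  pairwise suprema.\<close>

lemma kernel_op_inf: "kernel_op b (inf g h) = sup (kernel_op b g) (kernel_op b h)"
proof -
  have eq: "ereal r - inf u v = sup (ereal r - u) (ereal r - v)" for r u v
    by (cases u; cases v) (auto simp: inf_min sup_max min_def max_def)
  show ?thesis
    by (simp only: kernel_op_def sup_fun_def inf_fun_def eq complete_lattice_class.SUP_sup_distrib)
qed

lemma Rg_sup: "f \<in> Rg b \<Longrightarrow> g \<in> Rg b \<Longrightarrow> sup f g \<in> Rg b"
  by (auto simp: Rg_def simp flip: kernel_op_inf)

text \<open>The preimage is the (max,+) Dirac function at \<open>y\<close>: the value infinity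
  removes every other index from the supremum.\<close>

lemma kernel_section_in_Rg: "(\<lambda>x. ereal (b x y)) \<in> Rg b"
proof -
  have "(SUP z. ereal (b x z) - (if z = y then 0 else \<infinity>)) = ereal (b x y)" for x
    by (rule antisym; (rule SUP_least | rule SUP_upper2[of y])) auto
  then have "kernel_op b (\<lambda>z. if z = y then 0 else \<infinity>) = (\<lambda>x. ereal (b x y))"
    by (simp add: kernel_op_def)
  then show ?thesis by (metis kernel_op_in_Rg)
qed

text \<open>With the inequalities in this direction, the equivalence rests on the two operators
  being mutually inverse antitone bijections between the ranges.\<close>

lemma kernel_op_galois_Rg:
  assumes "f \<in> Rg b" "g \<in> Rg_dual b"
  shows "f \<le> kernel_op b g \<longleftrightarrow> g \<le> kernel_dual_op b f"
  using assms
  by (metis kernel_op_dual_inverse kernel_dual_op_inverse kernel_op_antimono kernel_dual_op_antimono)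

text \<open>Evaluation at a point becomes an order condition inside the range, which isomorphisms
  preserve. Expanding \<open>f\<close> as \<open>kernel_op b (kernel_dual_op b f)\<close> turns the
  bound at \<open>x\<close> into a lower bound on \<open>kernel_dual_op b f\<close>.\<close>

lemma Rg_le_real_iff:
  assumes "f \<in> Rg b"
  shows "f x \<le> ereal r \<longleftrightarrow> f \<le> (\<lambda>x'. kernel_op b (\<lambda>y. ereal (b x y)) x' + ereal r)"
proof -
  have "f x \<le> ereal r \<longleftrightarrow> kernel_op b (kernel_dual_op b f) x \<le> ereal r"
    by (simp add: assms kernel_op_dual_inverse)
  also have "\<dots> \<longleftrightarrow> (\<lambda>y. ereal (b x y) + ereal (- r)) \<le> kernel_dual_op b f"
    unfolding kernel_op_def[of b "kernel_dual_op b f"] SUP_le_iff le_fun_def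
      ereal_minus_le_swap[of _ _ "ereal r"] by simp
  also have "\<dots> \<longleftrightarrow> f \<le> kernel_op b (\<lambda>y. ereal (b x y) + ereal (- r))"
    by (rule kernel_op_galois_Rg[symmetric, OF assms])
      (unfold Rg_dual_eq, rule Rg_add_real, rule kernel_section_in_Rg[of "\<lambda>y x. b x y"])
  also have "\<dots> \<longleftrightarrow> f \<le> (\<lambda>x'. kernel_op b (\<lambda>y. ereal (b x y)) x' + ereal r)"
    by (simp only: kernel_op_add_real) simp
  finally show ?thesis .
qed

section \<open>Isomorphisms\<close>

text \<open>Since \<open>f \<le> g\<close> means \<open>sup f g = g\<close>, suprema determine the
  order; conversely an order isomorphism preserves least upper bounds. The order form passes easily
  through antitone operators.\<close>

lemma maxplus_isomorphism_iff_order: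
  assumes "\<And>f g. f \<in> G \<Longrightarrow> g \<in> G \<Longrightarrow> sup f g \<in> G"
    and "\<And>f g. f \<in> H \<Longrightarrow> g \<in> H \<Longrightarrow> sup f g \<in> H"
  shows "maxplus_isomorphism G H J \<longleftrightarrow>
    bij_betw J G H \<and> (\<forall>f\<in>G. \<forall>g\<in>G. J f \<le> J g \<longleftrightarrow> f \<le> g) \<and>
    (\<forall>f\<in>G. \<forall>r::real. J (\<lambda>x. f x + ereal r) = (\<lambda>z. J f z + ereal r))"
proof -
  have "J f \<le> J g \<longleftrightarrow> f \<le> g"
    if "bij_betw J G H" "\<forall>f\<in>G. \<forall>g\<in>G. J (sup f g) = sup (J f) (J g)" "f \<in> G" "g \<in> G" for f g
    using that assms(1) unfolding bij_betw_def inj_on_def le_iff_sup by metis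
  moreover have "J (sup f g) = sup (J f) (J g)"
    if J: "bij_betw J G H" "\<forall>f\<in>G. \<forall>g\<in>G. J f \<le> J g \<longleftrightarrow> f \<le> g" and fg: "f \<in> G" "g \<in> G" for f g
  proof (rule antisym)
    have "J f \<in> H" "J g \<in> H" using J(1) fg by (auto simp: bij_betw_def)
    \<comment> \<open>The supremum of the images lies in \<open>H\<close>, so it has a preimage
      \<open>k\<close>, which is an upper bound of \<open>f\<close> and \<open>g\<close>.\<close>
    then obtain k where k: "k \<in> G" "J k = sup (J f) (J g)"
      using assms(2) J(1) by (metis bij_betw_def imageE)
    then have "f \<le> k" "g \<le> k" using J(2) fg by (metis sup_ge1, metis sup_ge2)
    then have "sup f g \<le> k" by simp
    then show "J (sup f g) \<le> sup (J f) (J g)" using J(2) fg k assms(1) by metis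
    show "sup (J f) (J g) \<le> J (sup f g)" using J(2) fg assms(1) by simp
  qed
  ultimately show ?thesis unfolding maxplus_isomorphism_def by blast
qed

lemma maxplus_isomorphism_Rg_iff:
  "maxplus_isomorphism (Rg b) (Rg c) J \<longleftrightarrow>
    bij_betw J (Rg b) (Rg c) \<and> (\<forall>f\<in>Rg b. \<forall>g\<in>Rg b. J f \<le> J g \<longleftrightarrow> f \<le> g) \<and>
    (\<forall>f\<in>Rg b. \<forall>r::real. J (\<lambda>x. f x + ereal r) = (\<lambda>z. J f z + ereal r))"
  by (intro maxplus_isomorphism_iff_order Rg_sup)

lemma maxplus_isomorphism_inv_into:
  assumes J: "maxplus_isomorphism (Rg b) (Rg c) J"
  shows "maxplus_isomorphism (Rg c) (Rg b) (inv_into (Rg b) J)"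
proof -
  let ?I = "inv_into (Rg b) J"
  have bij: "bij_betw J (Rg b) (Rg c)"
    and ord: "\<And>f g. f \<in> Rg b \<Longrightarrow> g \<in> Rg b \<Longrightarrow> J f \<le> J g \<longleftrightarrow> f \<le> g"
    and add: "\<And>f r. f \<in> Rg b \<Longrightarrow> J (\<lambda>x. f x + ereal r) = (\<lambda>z. J f z + ereal r)"
    using J by (auto simp: maxplus_isomorphism_Rg_iff)
  have I: "?I h \<in> Rg b" "J (?I h) = h" if "h \<in> Rg c" for h
    using bij that by (auto simp: bij_betw_def inv_into_into f_inv_into_f)
  have "?I (\<lambda>z. h z + ereal r) = (\<lambda>x. ?I h x + ereal r)" if "h \<in> Rg c" for h r
  proof (rule inv_into_f_eq)
    show "inj_on J (Rg b)" using bij by (simp add: bij_betw_def)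
    show "(\<lambda>x. ?I h x + ereal r) \<in> Rg b" by (simp add: Rg_add_real I that)
    show "J (\<lambda>x. ?I h x + ereal r) = (\<lambda>z. h z + ereal r)" by (simp add: add I that)
  qed
  then show ?thesis
    unfolding maxplus_isomorphism_Rg_iff using bij_betw_inv_into[OF bij] ord I by metis
qed

text \<open>Two order reversals, by \<open>kernel_op b\<close> and \<open>kernel_dual_op c\<close>,
  cancel, and so do the two sign changes they impose on added scalars.\<close>

lemma maxplus_isomorphism_dual:
  assumes J: "maxplus_isomorphism (Rg b) (Rg c) J"
  shows "maxplus_isomorphism (Rg_dual b) (Rg_dual c) (\<lambda>g. kernel_dual_op c (J (kernel_op b g)))"
    (is "maxplus_isomorphism _ _ ?J")
proof -
  let ?I = "inv_into (Rg b) J"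
  have bij: "bij_betw J (Rg b) (Rg c)"
    and ord: "\<And>f g. f \<in> Rg b \<Longrightarrow> g \<in> Rg b \<Longrightarrow> J f \<le> J g \<longleftrightarrow> f \<le> g"
    and add: "\<And>f r. f \<in> Rg b \<Longrightarrow> J (\<lambda>x. f x + ereal r) = (\<lambda>z. J f z + ereal r)"
    using J by (auto simp: maxplus_isomorphism_Rg_iff)
  have JR: "J f \<in> Rg c" if "f \<in> Rg b" for f using bij that by (auto simp: bij_betw_def)
  have I: "?I h \<in> Rg b" "J (?I h) = h" if "h \<in> Rg c" for h
    using bij that by (auto simp: bij_betw_def inv_into_into f_inv_into_f)
  have IJ: "?I (J f) = f" if "f \<in> Rg b" for f
    using bij that by (simp add: bij_betw_def inv_into_f_f)
  have "bij_betw ?J (Rg_dual b) (Rg_dual c)"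
    by (rule bij_betw_byWitness[where f' = "\<lambda>h. kernel_dual_op b (?I (kernel_op c h))"])
      (auto simp: JR I IJ kernel_op_in_Rg kernel_dual_op_in_Rg_dual kernel_dual_op_inverse
        kernel_op_dual_inverse)
  moreover have "?J f \<le> ?J g \<longleftrightarrow> f \<le> g" if "f \<in> Rg_dual b" "g \<in> Rg_dual b" for f g
  proof -
    have "?J f \<le> ?J g \<longleftrightarrow> J (kernel_op b g) \<le> J (kernel_op b f)"
      by (metis JR kernel_op_in_Rg kernel_op_dual_inverse kernel_op_antimono kernel_dual_op_antimono)
    also have "\<dots> \<longleftrightarrow> kernel_op b g \<le> kernel_op b f"
      by (simp add: ord kernel_op_in_Rg)
    also have "\<dots> \<longleftrightarrow> f \<le> g"
      using that by (metis kernel_dual_op_inverse kernel_op_antimono kernel_dual_op_antimono)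
    finally show ?thesis .
  qed
  moreover have "?J (\<lambda>y. g y + ereal r) = (\<lambda>z. ?J g z + ereal r)" for g r
    by (simp add: kernel_op_add_real add kernel_op_in_Rg kernel_dual_op_eq del: uminus_ereal.simps)
  ultimately show ?thesis
    unfolding Rg_dual_eq maxplus_isomorphism_Rg_iff by blast
qed

text \<open>Transposing both kernels exchanges the ranges with the dual ranges, so one construction
  serves both directions.\<close>

lemma maxplus_isomorphism_dual_iff:
  "(\<exists>J. maxplus_isomorphism (Rg b) (Rg c) J) \<longleftrightarrow>
   (\<exists>J. maxplus_isomorphism (Rg_dual b) (Rg_dual c) J)"
  using maxplus_isomorphism_dual[of b c] maxplus_isomorphism_dual[of "\<lambda>y x. b x y" "\<lambda>y x. c x y"]
  by (auto simp: Rg_dual_eq)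

section \<open>Sup-irreducible elements\<close>

lemma sup_irreducible_in_finite:
  assumes f: "sup_irreducible_in G f"
    and G: "\<And>g h. g \<in> G \<Longrightarrow> h \<in> G \<Longrightarrow> sup g h \<in> G"
    and "finite D" "D \<noteq> {}" "D \<subseteq> G" "f = Sup D"
  shows "f \<in> D"
proof -
  \<comment> \<open>Membership of \<open>Sup D\<close> in \<open>G\<close> is carried along because
    irreducibility only concerns decompositions within \<open>G\<close>.\<close>
  have "Sup D \<in> G \<and> (f = Sup D \<longrightarrow> f \<in> D)"
    using assms(3-5)
  proof (induction D rule: finite_ne_induct)
    case (insert g D)
    then have "g \<in> G" "Sup D \<in> G" "f = Sup D \<longrightarrow> f \<in> D" by blast+
    moreover from this have "sup g (Sup D) \<in> G" using G by blast
    moreover have "f = sup g (Sup D) \<longrightarrow> f = g \<or> f = Sup D"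
      using f \<open>g \<in> G\<close> \<open>Sup D \<in> G\<close> unfolding sup_irreducible_in_def by blast
    ultimately show ?case unfolding complete_lattice_class.Sup_insert by blast
  qed simp
  then show ?thesis using assms by simp
qed

text \<open>A decomposition of \<open>J f\<close> in \<open>H\<close> pulls back along the bijection
  to a decomposition of \<open>f\<close> in \<open>G\<close>.\<close>

lemma sup_irreducible_in_image:
  assumes J: "maxplus_isomorphism G H J" and f: "sup_irreducible_in G f"
    and G: "\<And>g h. g \<in> G \<Longrightarrow> h \<in> G \<Longrightarrow> sup g h \<in> G"
  shows "sup_irreducible_in H (J f)"
  unfolding sup_irreducible_in_def
proof (intro conjI ballI impI)
  have bij: "J ` G = H" "inj_on J G" and fG: "f \<in> G"
    using J f by (auto simp: maxplus_isomorphism_def bij_betw_def sup_irreducible_in_def)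
  then show "J f \<in> H" by blast
  fix g h assume "g \<in> H" "h \<in> H" and eq: "J f = sup g h"
  then obtain g' h' where gh: "g' \<in> G" "h' \<in> G" "g = J g'" "h = J h'" using bij by blast
  then have "J f = J (sup g' h')" using J eq by (simp add: maxplus_isomorphism_def)
  then have "f = sup g' h'" using bij fG gh G by (metis inj_onD)
  then have "f = g' \<or> f = h'" using f gh unfolding sup_irreducible_in_def by blast
  then show "J f = g \<or> J f = h" using gh by blast
qed

text \<open>If $f$ differed from every $b(\cdot,y) - B^\circ f(y)$, lower semicontinuity of
  $B^\circ f$ and compactness would split $f$ into finitely many strictly smaller elements of the
  range. The assumption $f + 1 \neq f$ excludes the constants $\pm\infty$.\<close>

lemma sup_irreducible_in_Rg:
  fixes b :: "'x \<Rightarrow> 'y::topological_space \<Rightarrow> real"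
  assumes comp: "compact (UNIV :: 'y set)"
    and cont: "\<And>x. continuous_on UNIV (b x)"
    and f: "sup_irreducible_in (Rg b) f" and ne: "(\<lambda>x. f x + ereal 1) \<noteq> f"
  obtains y r where "f = (\<lambda>x. ereal (b x y) + ereal r)"
proof -
  define g where "g = kernel_dual_op b f"
  have fR: "f \<in> Rg b" using f by (simp add: sup_irreducible_in_def)
  have fg: "f x = (SUP y. ereal (b x y) - g y)" for x
    using kernel_op_dual_inverse[OF fR] by (metis g_def kernel_op_def)
  \<comment> \<open>Here \<open>g\<close> is a supremum of functions
    \<open>ereal (b x' z) - f x'\<close> of \<open>z\<close>, each continuous, or constant when
    \<open>f x'\<close> is infinite. So the strict sublevel sets of
    \<open>ereal (b x z) - g z\<close> are open.\<close>
  have op: "open {z. ereal (b x z) - g z < ereal \<alpha>}" for x \<alpha>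
  proof -
    have "{z. ereal (b x z) - g z < ereal \<alpha>} = (\<Union>x'. {z. ereal (b x z - \<alpha>) < ereal (b x' z) - f x'})"
    proof -
      have "ereal u - v < ereal \<alpha> \<longleftrightarrow> ereal (u - \<alpha>) < v" for u v by (cases v) auto
      then show ?thesis by (auto simp: g_def kernel_dual_op_def less_SUP_iff)
    qed
    moreover have "open {z. ereal (b x z - \<alpha>) < ereal (b x' z) - f x'}" for x'
      by (cases "f x'") (auto intro!: open_Collect_less continuous_intros cont)
    ultimately show ?thesis by (simp add: open_UN)
  qed
  have "\<exists>y. f = (\<lambda>x. ereal (b x y) - g y)"
  proof (rule ccontr)
    assume contra: "\<not> ?thesis"
    \<comment> \<open>Each term lies below \<open>f\<close> and differs from it, so the inequality
      is strict at some point, where a real number separates the two values.\<close>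
    have "\<exists>x \<alpha>. ereal (b x y) - g y < ereal \<alpha> \<and> ereal \<alpha> < f x" for y
    proof -
      have "ereal (b x y) - g y \<le> f x" for x unfolding fg by (rule SUP_upper) simp
      moreover have "f \<noteq> (\<lambda>x. ereal (b x y) - g y)" using contra by blast
      then obtain x where "f x \<noteq> ereal (b x y) - g y" by (auto simp: fun_eq_iff)
      ultimately have "ereal (b x y) - g y < f x" by (metis order_le_less)
      then show ?thesis using ereal_dense2 by blast
    qed
    then obtain p \<alpha> where p: "\<And>y. ereal (b (p y) y) - g y < ereal (\<alpha> y)" "\<And>y. ereal (\<alpha> y) < f (p y)"
      by metis
    define U where "U y = {z. ereal (b (p y) z) - g z < ereal (\<alpha> y)}" for y
    \<comment> \<open>\<open>k y\<close> is the part of the supremum for \<open>f\<close> with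
      indices in \<open>U y\<close>. By the choice of \<open>U y\<close> it is at most
      \<open>\<alpha> y\<close> at \<open>p y\<close>, hence different from
      \<open>f\<close>.\<close>
    define k where "k y = kernel_op b (\<lambda>z. if z \<in> U y then g z else \<infinity>)" for y
    have openU: "open (U y)" for y unfolding U_def by (rule op)
    have cover: "UNIV \<subseteq> (\<Union>y\<in>UNIV. U y)" using p(1) by (auto simp: U_def)
    obtain D where D: "finite D" "UNIV \<subseteq> (\<Union>y\<in>D. U y)"
      by (rule compactE_image[OF comp openU cover])
    have kR: "k y \<in> Rg b" for y by (simp add: k_def kernel_op_in_Rg)
    have "f = Sup (k ` D)"
    proof (rule antisym)
      show "Sup (k ` D) \<le> f"
      proof (rule SUP_least)
        fix y
        show "k y \<le> f" unfolding k_def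
          by (rule order_trans[OF kernel_op_antimono[of g]])
            (auto simp: le_fun_def g_def kernel_op_dual_inverse[OF fR])
      qed
      show "f \<le> Sup (k ` D)"
        unfolding le_fun_def
      proof
        fix x
        show "f x \<le> (Sup (k ` D)) x" unfolding fg
        proof (rule SUP_least)
          fix z
          obtain y where y: "y \<in> D" "z \<in> U y" using D by auto
          have "ereal (b x z) - g z \<le> k y x"
            unfolding k_def kernel_op_def by (rule SUP_upper2[of z]) (use y in auto)
          also have "\<dots> \<le> (Sup (k ` D)) x" using y by (auto intro: SUP_upper)
          finally show "ereal (b x z) - g z \<le> (Sup (k ` D)) x" .
        qed
      qed
    qed
    moreover have "D \<noteq> {}" using D by auto
    ultimately have "f \<in> k ` D"
      using sup_irreducible_in_finite[OF f Rg_sup, of "k ` D"] D kR by blast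
    then obtain y where "f = k y" by blast
    moreover have "k y (p y) \<le> ereal (\<alpha> y)"
      unfolding k_def kernel_op_def by (rule SUP_least) (auto simp: U_def)
    ultimately show False using p(2)[of y] by simp
  qed
  then obtain y where y: "f = (\<lambda>x. ereal (b x y) - g y)" ..
  \<comment> \<open>An infinite \<open>g y\<close> would make \<open>f\<close> an infinite constant,
    which is unchanged by adding 1.\<close>
  have "g y \<noteq> \<infinity>" "g y \<noteq> - \<infinity>" using ne unfolding y by auto
  then obtain r where "g y = ereal r" by (cases "g y") auto
  then have "f = (\<lambda>x. ereal (b x y) + ereal (- r))" using y by simp
  then show thesis by (rule that)
qed

section \<open>Isomorphisms are weighted compositions\<close>

text \<open>The image is again sup-irreducible, and by injectivity of \<open>J\<close> adding 1
  changes it, as it changes the real-valued \<open>b(\<cdot>,y)\<close>. The classification in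
  \<open>Rg c\<close> then applies.\<close>

lemma isomorphism_generator:
  fixes b :: "'x \<Rightarrow> 'y \<Rightarrow> real" and c :: "'x2 \<Rightarrow> 'y2::topological_space \<Rightarrow> real"
  assumes "compact (UNIV :: 'y2 set)" "\<And>x. continuous_on UNIV (c x)"
    and fr: "fully_reduced b" and J: "maxplus_isomorphism (Rg b) (Rg c) J"
  shows "\<exists>y' r. J (\<lambda>x. ereal (b x y)) = (\<lambda>z. ereal (c z y') + ereal r)"
proof -
  let ?f = "\<lambda>x. ereal (b x y)"
  have irr: "sup_irreducible_in (Rg b) ?f" using fr by (simp add: fully_reduced_def)
  have fR: "?f \<in> Rg b" by (rule kernel_section_in_Rg)
  have add: "\<And>f r. f \<in> Rg b \<Longrightarrow> J (\<lambda>x. f x + ereal r) = (\<lambda>z. J f z + ereal r)"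
    using J by (auto simp: maxplus_isomorphism_def)
  have "(\<lambda>z. J ?f z + ereal 1) \<noteq> J ?f"
  proof
    assume "(\<lambda>z. J ?f z + ereal 1) = J ?f"
    moreover have "J (\<lambda>x. ?f x + ereal 1) = (\<lambda>z. J ?f z + ereal 1)"
      by (rule add[OF fR])
    ultimately have "J (\<lambda>x. ?f x + ereal 1) = J ?f" by (rule trans[rotated])
    then have "(\<lambda>x. ?f x + ereal 1) = ?f"
      using J fR Rg_add_real[OF fR, of 1] unfolding maxplus_isomorphism_def bij_betw_def
      by (metis inj_onD)
    then show False by (simp add: fun_eq_iff)
  qed
  then show ?thesis
    using sup_irreducible_in_Rg[OF assms(1,2) sup_irreducible_in_image[OF J irr Rg_sup]] by metis
qed

text \<open>The inverse of \<open>J\<close> sends each \<open>c(\<cdot>,y')\<close> to a translate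
  of some \<open>b(\<cdot>,y)\<close>, which defines \<open>\<sigma>\<close> and
  \<open>\<phi>\<close>. Reducedness of \<open>c\<close> makes \<open>\<sigma>\<close> injective;
  applying \<open>J\<close> itself and reducedness of \<open>b\<close> make it surjective.\<close>

lemma isomorphism_generators:
  fixes b :: "'x \<Rightarrow> 'y::topological_space \<Rightarrow> real"
    and c :: "'x2 \<Rightarrow> 'y2::topological_space \<Rightarrow> real"
  assumes "compact (UNIV :: 'y set)" "compact (UNIV :: 'y2 set)"
    and "\<And>x. continuous_on UNIV (b x)" "\<And>x. continuous_on UNIV (c x)"
    and fr: "fully_reduced b" "fully_reduced c"
    and J: "maxplus_isomorphism (Rg b) (Rg c) J"
  obtains \<sigma> :: "'y2 \<Rightarrow> 'y" and \<phi> :: "'y2 \<Rightarrow> real" where "bij \<sigma>"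
    "\<And>y'. (\<lambda>z. ereal (c z y')) = (\<lambda>z. J (\<lambda>x. ereal (b x (\<sigma> y'))) z + ereal (\<phi> y'))"
proof -
  let ?I = "inv_into (Rg b) J"
  have bij: "bij_betw J (Rg b) (Rg c)"
    and add: "\<And>f r. f \<in> Rg b \<Longrightarrow> J (\<lambda>x. f x + ereal r) = (\<lambda>z. J f z + ereal r)"
    using J by (auto simp: maxplus_isomorphism_def)
  note bR = kernel_section_in_Rg[of b] and cR = kernel_section_in_Rg[of c]
  have "\<exists>y r. ?I (\<lambda>z. ereal (c z y')) = (\<lambda>x. ereal (b x y) + ereal r)" for y'
    using isomorphism_generator[OF assms(1,3) fr(2) maxplus_isomorphism_inv_into[OF J]] .
  then obtain \<sigma> \<phi> where sp: "\<And>y'. ?I (\<lambda>z. ereal (c z y')) = (\<lambda>x. ereal (b x (\<sigma> y')) + ereal (\<phi> y'))"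
    by metis
  have eq: "(\<lambda>z. ereal (c z y')) = (\<lambda>z. J (\<lambda>x. ereal (b x (\<sigma> y'))) z + ereal (\<phi> y'))" for y'
    using arg_cong[OF sp[of y'], of J] bij cR bR
    by (simp only: add f_inv_into_f bij_betw_def)
  have "inj \<sigma>"
  proof (rule injI)
    fix y1 y2 assume "\<sigma> y1 = \<sigma> y2"
    \<comment> \<open>The common value of \<open>J\<close> at \<open>z\<close> is finite, because
      \<open>eq\<close> equates it with a real number up to a real shift; so it can be
      eliminated.\<close>
    have "ereal (c z y1) = ereal (c z y2) + ereal (\<phi> y1 - \<phi> y2)" for z
      using fun_cong[OF eq[of y1], of z] fun_cong[OF eq[of y2], of z] \<open>\<sigma> y1 = \<sigma> y2\<close>
      by (cases "J (\<lambda>x. ereal (b x (\<sigma> y2))) z") auto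
    then have "(\<lambda>z. c z y1) = (\<lambda>z. c z y2 + (\<phi> y1 - \<phi> y2))" by auto
    then show "y1 = y2" using fr(2) unfolding fully_reduced_def by blast
  qed
  moreover have "\<exists>y'. y = \<sigma> y'" for y
  proof -
    obtain y' r where J: "J (\<lambda>x. ereal (b x y)) = (\<lambda>z. ereal (c z y') + ereal r)"
      using isomorphism_generator[OF assms(2,4) fr(1) J] by metis
    also have "\<dots> = (\<lambda>z. J (\<lambda>x. ereal (b x (\<sigma> y'))) z + ereal (\<phi> y' + r))"
      unfolding fun_cong[OF eq] by (simp add: add.assoc)
    also have "\<dots> = J (\<lambda>x. ereal (b x (\<sigma> y')) + ereal (\<phi> y' + r))"
      using add[OF bR] by simp
    finally have "(\<lambda>x. ereal (b x y)) = (\<lambda>x. ereal (b x (\<sigma> y')) + ereal (\<phi> y' + r))"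
      using bij bR Rg_add_real[OF bR] unfolding bij_betw_def by (metis inj_onD)
    then have "(\<lambda>x. b x y) = (\<lambda>x. b x (\<sigma> y') + (\<phi> y' + r))" by (auto simp: fun_eq_iff)
    then show ?thesis using fr(1) unfolding fully_reduced_def by metis
  qed
  ultimately show thesis using that eq by (metis bij_def surj_def)
qed

lemma isomorphism_weighted_composition:
  fixes b :: "'x::topological_space \<Rightarrow> 'y \<Rightarrow> real"
    and c :: "'x2::topological_space \<Rightarrow> 'y2 \<Rightarrow> real"
  assumes "compact (UNIV :: 'x set)" "compact (UNIV :: 'x2 set)"
    and "\<And>y. continuous_on UNIV (\<lambda>x. b x y)" "\<And>y. continuous_on UNIV (\<lambda>x. c x y)"
    and fr: "fully_reduced b" "fully_reduced c"
    and J: "maxplus_isomorphism (Rg b) (Rg c) J"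
  obtains \<tau> :: "'x2 \<Rightarrow> 'x" and \<psi> :: "'x2 \<Rightarrow> real" where "bij \<tau>"
    "\<And>f. f \<in> Rg b \<Longrightarrow> J f = (\<lambda>z. ereal (\<psi> z) + f (\<tau> z))"
proof -
  let ?J = "\<lambda>g. kernel_dual_op c (J (kernel_op b g))"
  let ?e = "\<lambda>x. kernel_op b (\<lambda>y. ereal (b x y))"
  let ?d = "\<lambda>x'. kernel_op c (\<lambda>y'. ereal (c x' y'))"
  have ord: "\<And>f g. f \<in> Rg b \<Longrightarrow> g \<in> Rg b \<Longrightarrow> J f \<le> J g \<longleftrightarrow> f \<le> g"
    and add: "\<And>f r. f \<in> Rg b \<Longrightarrow> J (\<lambda>x. f x + ereal r) = (\<lambda>z. J f z + ereal r)"
    and JR: "\<And>f. f \<in> Rg b \<Longrightarrow> J f \<in> Rg c"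
    using J by (auto simp: maxplus_isomorphism_Rg_iff bij_betw_def)
  obtain \<tau> :: "'x2 \<Rightarrow> 'x" and \<psi> :: "'x2 \<Rightarrow> real" where \<tau>: "bij \<tau>"
    and eq: "\<And>x'. (\<lambda>y'. ereal (c x' y')) = (\<lambda>y'. ?J (\<lambda>y. ereal (b (\<tau> x') y)) y' + ereal (\<psi> x'))"
    using isomorphism_generators[OF assms(1,2), of "\<lambda>y x. b x y" "\<lambda>y x. c x y" ?J]
      assms(3,4) fr maxplus_isomorphism_dual[OF J]
    by (simp add: Rg_dual_eq fully_reduced_transpose) metis
  \<comment> \<open>Apply \<open>kernel_op c\<close> to \<open>eq\<close>: it undoes
    \<open>kernel_dual_op c\<close> on the range and flips the sign of \<open>\<psi> x'\<close>,
    which then changes sides.\<close>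
  have e: "J (?e (\<tau> x')) = (\<lambda>z. ?d x' z + ereal (\<psi> x'))" for x'
    unfolding eq kernel_op_add_real
    by (simp add: kernel_op_dual_inverse JR kernel_op_in_Rg add.assoc)
  have "J f x' = ereal (\<psi> x') + f (\<tau> x')" if f: "f \<in> Rg b" for f x'
  proof -
    \<comment> \<open>An extended real is determined by its real upper bounds, so it suffices to
      compare these. The functions \<open>?e (\<tau> x')\<close> and \<open>?d x'\<close> detect
      them, and \<open>J\<close> carries one to a translate of the other.\<close>
    have *: "J f x' \<le> ereal r \<longleftrightarrow> f (\<tau> x') \<le> ereal (r - \<psi> x')" for r
    proof -
      have "f (\<tau> x') \<le> ereal (r - \<psi> x') \<longleftrightarrow> f \<le> (\<lambda>x. ?e (\<tau> x') x + ereal (r - \<psi> x'))"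
        by (rule Rg_le_real_iff[OF f])
      also have "\<dots> \<longleftrightarrow> J f \<le> J (\<lambda>x. ?e (\<tau> x') x + ereal (r - \<psi> x'))"
        using ord[OF f Rg_add_real[OF kernel_op_in_Rg]] by simp
      also have "J (\<lambda>x. ?e (\<tau> x') x + ereal (r - \<psi> x')) = (\<lambda>z. ?d x' z + ereal r)"
        unfolding add[OF kernel_op_in_Rg] e by (simp add: add.assoc)
      also have "J f \<le> \<dots> \<longleftrightarrow> J f x' \<le> ereal r"
        by (rule Rg_le_real_iff[OF JR[OF f], symmetric])
      finally show ?thesis by simp
    qed
    have **: "u \<le> ereal (r - s) \<longleftrightarrow> ereal s + u \<le> ereal r" for r s u by (cases u) auto
    show ?thesis
      by (rule antisym; rule ereal_le_real) (simp_all add: * **)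
  qed
  then show thesis by (intro that[OF \<tau>] ext)
qed

text \<open>Reindexing the supremum along \<open>\<sigma>\<close> shows that the map sends
  \<open>kernel_op b g\<close> to the image under \<open>kernel_op c\<close> of
  \<open>g \<circ> \<sigma> + \<phi>\<close>.\<close>

lemma weighted_composition_isomorphism:
  fixes b :: "'x \<Rightarrow> 'y \<Rightarrow> real" and c :: "'x2 \<Rightarrow> 'y2 \<Rightarrow> real"
  assumes \<tau>: "bij \<tau>" and \<sigma>: "bij \<sigma>"
    and c: "\<And>x' y'. c x' y' = \<psi> x' + b (\<tau> x') (\<sigma> y') + \<phi> y'"
  shows "maxplus_isomorphism (Rg b) (Rg c) (\<lambda>f z. ereal (\<psi> z) + f (\<tau> z))"
proof -
  let ?J = "\<lambda>f z. ereal (\<psi> z) + f (\<tau> z)"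
  have J: "?J (kernel_op b g) = kernel_op c (\<lambda>y'. g (\<sigma> y') + ereal (\<phi> y'))" for g
  proof
    fix z
    have "ereal (c z y') - (g (\<sigma> y') + ereal (\<phi> y'))
        = ereal (b (\<tau> z) (\<sigma> y')) - g (\<sigma> y') + ereal (\<psi> z)" for y'
      unfolding c by (cases "g (\<sigma> y')") auto
    then have "kernel_op c (\<lambda>y'. g (\<sigma> y') + ereal (\<phi> y')) z
        = (SUP y'. ereal (b (\<tau> z) (\<sigma> y')) - g (\<sigma> y')) + ereal (\<psi> z)"
      by (simp add: kernel_op_def ereal_SUP_add_real)
    also have "(SUP y'. ereal (b (\<tau> z) (\<sigma> y')) - g (\<sigma> y')) = (SUP y\<in>\<sigma> ` UNIV. ereal (b (\<tau> z) y) - g y)"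
      by (simp add: image_image)
    finally show "?J (kernel_op b g) z = kernel_op c (\<lambda>y'. g (\<sigma> y') + ereal (\<phi> y')) z"
      using \<sigma> by (simp add: kernel_op_def bij_def add.commute)
  qed
  have surj: "?J ` Rg b = Rg c"
  proof
    show "?J ` Rg b \<subseteq> Rg c" by (auto simp: Rg_def J)
    show "Rg c \<subseteq> ?J ` Rg b"
    proof
      fix f assume "f \<in> Rg c"
      then obtain h where h: "f = kernel_op c h" by (auto simp: Rg_def)
      \<comment> \<open>This solves \<open>g \<circ> \<sigma> + \<phi> = h\<close>.\<close>
      define g where "g y = h (inv \<sigma> y) + ereal (- \<phi> (inv \<sigma> y))" for y
      have "(\<lambda>y'. g (\<sigma> y') + ereal (\<phi> y')) = h"
        using \<sigma> by (simp add: g_def bij_def inv_f_f add.assoc)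
      then have "f = ?J (kernel_op b g)" unfolding J h by simp
      then show "f \<in> ?J ` Rg b" by (simp add: kernel_op_in_Rg)
    qed
  qed
  have le: "ereal r + u \<le> ereal r + v \<longleftrightarrow> u \<le> v" for r u v by (cases u; cases v) auto
  \<comment> \<open>Every point of the domain of \<open>f\<close> and \<open>g\<close> is some
    \<open>\<tau> z\<close>, so the pointwise comparison transfers; injectivity follows by
    antisymmetry.\<close>
  have ord: "?J f \<le> ?J g \<longleftrightarrow> f \<le> g" for f g
    unfolding le_fun_def le using \<tau> by (metis bij_pointE)
  have "inj_on ?J (Rg b)" by (rule inj_onI) (metis ord antisym order_refl)
  then have "bij_betw ?J (Rg b) (Rg c)" using surj by (simp add: bij_betw_def)
  then show ?thesis
    unfolding maxplus_isomorphism_Rg_iff using ord by (simp add: add.assoc)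
qed

section \<open>Continuity\<close>

lemma homeomorphism_imp_bij: "homeomorphism UNIV UNIV f g \<Longrightarrow> bij f"
  by (rule o_bij[of g]) (auto simp: homeomorphism_def fun_eq_iff)

text \<open>The maps $x \mapsto b(x,y_1) - b(x,y_2)$ separate the points of $X$ and do not see the
  weight $\psi$, so they exhibit the graph of $\tau$ as a closed, hence compact, set.\<close>

lemma homeomorphism_of_kernel_identity:
  fixes b :: "'x::t2_space \<Rightarrow> 'y \<Rightarrow> real" and c :: "'x2::t2_space \<Rightarrow> 'y2 \<Rightarrow> real"
  assumes comp: "compact (UNIV :: 'x set)" "compact (UNIV :: 'x2 set)"
    and cont: "\<And>y. continuous_on UNIV (\<lambda>x. b x y)" "\<And>y. continuous_on UNIV (\<lambda>x. c x y)"
    and fr: "fully_reduced b"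
    and \<tau>: "bij \<tau>" and \<sigma>: "bij \<sigma>"
    and c: "\<And>x' y'. c x' y' = \<psi> x' + b (\<tau> x') (\<sigma> y') + \<phi> y'"
  shows "\<exists>\<tau>'. homeomorphism UNIV UNIV \<tau> \<tau>'" and "continuous_on UNIV \<psi>"
proof -
  \<comment> \<open>This is \<open>b (\<tau> x') y1 - b (\<tau> x') y2\<close> rewritten through the
    kernel identity, so that neither \<open>\<tau>\<close> nor \<open>\<psi>\<close> occurs and
    continuity in \<open>x'\<close> is visible.\<close>
  let ?k = "\<lambda>x' y1 y2. c x' (inv \<sigma> y1) - c x' (inv \<sigma> y2) - \<phi> (inv \<sigma> y1) + \<phi> (inv \<sigma> y2)"
  define \<Gamma> where "\<Gamma> = {(x', x). \<forall>y1 y2. b x y1 - b x y2 = ?k x' y1 y2}"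
  have k: "?k x' y1 y2 = b (\<tau> x') y1 - b (\<tau> x') y2" for x' y1 y2
    using \<sigma> by (simp add: c bij_def surj_f_inv_f)
  have graph: "(x', x) \<in> \<Gamma> \<longleftrightarrow> x = \<tau> x'" for x' x
  proof
    obtain y1 :: 'y where True by simp
    assume "(x', x) \<in> \<Gamma>"
    then have "b x y - b x y1 = b (\<tau> x') y - b (\<tau> x') y1" for y by (simp only: \<Gamma>_def k) simp
    then have "b x y = b (\<tau> x') y + (b x y1 - b (\<tau> x') y1)" for y by (simp add: algebra_simps)
    then show "x = \<tau> x'" using fr unfolding fully_reduced_def by blast
  qed (simp only: \<Gamma>_def k, simp)
  have "closed \<Gamma>"
    unfolding \<Gamma>_def case_prod_beta
    by (intro closed_Collect_all closed_Collect_eq continuous_intros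
        continuous_on_compose2[OF cont(1)] continuous_on_compose2[OF cont(2)]) auto
  then have "compact \<Gamma>"
    using compact_Int_closed[OF compact_Times[OF comp(2,1)]] by simp
  \<comment> \<open>The projection \<open>fst\<close> is continuous and injective on the compact set
    \<open>\<Gamma>\<close>, so its inverse \<open>x' \<mapsto> (x', \<tau> x')\<close> is
    continuous.\<close>
  then have "continuous_on (fst ` \<Gamma>) (\<lambda>x'. (x', \<tau> x'))"
    by (intro continuous_on_inv continuous_intros) (auto simp: graph)
  moreover have "fst ` \<Gamma> = UNIV" using graph by force
  ultimately have cont\<tau>: "continuous_on UNIV \<tau>"
    using continuous_on_snd by fastforce
  then show "\<exists>\<tau>'. homeomorphism UNIV UNIV \<tau> \<tau>'"
    using homeomorphism_compact[OF comp(2)] \<tau> by (metis bij_def)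
  obtain y' :: 'y2 where True by simp
  have "\<psi> = (\<lambda>x'. c x' y' - b (\<tau> x') (\<sigma> y') - \<phi> y')" by (simp add: c)
  then show "continuous_on UNIV \<psi>"
    by (auto intro!: continuous_intros cont continuous_on_compose2[OF cont(1) cont\<tau>])
qed

theorem theorem27:
  fixes b :: "'x::t2_space \<Rightarrow> 'y::t2_space \<Rightarrow> real"
    and c :: "'x2::t2_space \<Rightarrow> 'y2::t2_space \<Rightarrow> real"
  assumes "compact (UNIV :: 'x set)" and "compact (UNIV :: 'y set)"
    and "compact (UNIV :: 'x2 set)" and "compact (UNIV :: 'y2 set)"
    and "continuous_on UNIV (\<lambda>(x, y). b x y)"
    and "continuous_on UNIV (\<lambda>(x', y'). c x' y')"
    and "fully_reduced b" and "fully_reduced c"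
  shows
    "((\<exists>J. maxplus_isomorphism (Rg b) (Rg c) J) \<longleftrightarrow>
      (\<exists>J. maxplus_isomorphism (Rg_dual b) (Rg_dual c) J)) \<and>
     ((\<exists>J. maxplus_isomorphism (Rg b) (Rg c) J) \<longleftrightarrow>
      (\<exists>(\<tau> :: 'x2 \<Rightarrow> 'x) (\<sigma> :: 'y2 \<Rightarrow> 'y) (\<psi> :: 'x2 \<Rightarrow> real) (\<phi> :: 'y2 \<Rightarrow> real).
         (\<exists>\<tau>'. homeomorphism UNIV UNIV \<tau> \<tau>') \<and> (\<exists>\<sigma>'. homeomorphism UNIV UNIV \<sigma> \<sigma>') \<and>
         continuous_on UNIV \<psi> \<and> continuous_on UNIV \<phi> \<and>
         (\<forall>x' y'. c x' y' = \<psi> x' + b (\<tau> x') (\<sigma> y') + \<phi> y'))) \<and>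
     ((\<exists>J. maxplus_isomorphism (Rg b) (Rg c) J) \<longleftrightarrow>
      (\<forall>J. maxplus_isomorphism (Rg b) (Rg c) J \<longrightarrow> weighted_composition_on (Rg b) J) \<and>
      (\<exists>J. maxplus_isomorphism (Rg b) (Rg c) J \<and> weighted_composition_on (Rg b) J)) \<and>
     ((\<exists>J. maxplus_isomorphism (Rg b) (Rg c) J) \<longleftrightarrow>
      (\<forall>J. maxplus_isomorphism (Rg_dual b) (Rg_dual c) J \<longrightarrow>
           weighted_composition_on (Rg_dual b) J) \<and>
      (\<exists>J. maxplus_isomorphism (Rg_dual b) (Rg_dual c) J \<and>
           weighted_composition_on (Rg_dual b) J))"
proof -
  have cb: "continuous_on UNIV (b x)" "continuous_on UNIV (\<lambda>x. b x y)" for x y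
    using continuous_on_compose2[OF assms(5) continuous_on_Pair[OF continuous_on_const continuous_on_id]]
      continuous_on_compose2[OF assms(5) continuous_on_Pair[OF continuous_on_id continuous_on_const]]
    by simp_all
  have cc: "continuous_on UNIV (c x)" "continuous_on UNIV (\<lambda>x. c x y)" for x y
    using continuous_on_compose2[OF assms(6) continuous_on_Pair[OF continuous_on_const continuous_on_id]]
      continuous_on_compose2[OF assms(6) continuous_on_Pair[OF continuous_on_id continuous_on_const]]
    by simp_all
  have iv: "weighted_composition_on (Rg b) J" if "maxplus_isomorphism (Rg b) (Rg c) J" for J
    using isomorphism_weighted_composition[OF assms(1,3) cb(2) cc(2) assms(7,8) that]
    unfolding weighted_composition_on_def by metis
  have v: "weighted_composition_on (Rg_dual b) J"
    if "maxplus_isomorphism (Rg_dual b) (Rg_dual c) J" for J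
    using isomorphism_weighted_composition[OF assms(2,4), of "\<lambda>y x. b x y" "\<lambda>y x. c x y" J]
      cb(1) cc(1) assms(7,8)[THEN fully_reduced_transpose] that
    unfolding weighted_composition_on_def Rg_dual_eq by metis
  have iii: "\<exists>(\<tau> :: 'x2 \<Rightarrow> 'x) (\<sigma> :: 'y2 \<Rightarrow> 'y) (\<psi> :: 'x2 \<Rightarrow> real) (\<phi> :: 'y2 \<Rightarrow> real).
         (\<exists>\<tau>'. homeomorphism UNIV UNIV \<tau> \<tau>') \<and> (\<exists>\<sigma>'. homeomorphism UNIV UNIV \<sigma> \<sigma>') \<and>
         continuous_on UNIV \<psi> \<and> continuous_on UNIV \<phi> \<and>
         (\<forall>x' y'. c x' y' = \<psi> x' + b (\<tau> x') (\<sigma> y') + \<phi> y')"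
    if J: "maxplus_isomorphism (Rg b) (Rg c) J" for J
  proof -
    obtain \<tau> :: "'x2 \<Rightarrow> 'x" and \<psi> :: "'x2 \<Rightarrow> real" where \<tau>: "bij \<tau>"
      and Jf: "\<And>f. f \<in> Rg b \<Longrightarrow> J f = (\<lambda>z. ereal (\<psi> z) + f (\<tau> z))"
      using isomorphism_weighted_composition[OF assms(1,3) cb(2) cc(2) assms(7,8) J] by metis
    obtain \<sigma> :: "'y2 \<Rightarrow> 'y" and \<phi> :: "'y2 \<Rightarrow> real" where \<sigma>: "bij \<sigma>"
      and eq: "\<And>y'. (\<lambda>z. ereal (c z y')) = (\<lambda>z. J (\<lambda>x. ereal (b x (\<sigma> y'))) z + ereal (\<phi> y'))"
      using isomorphism_generators[OF assms(2,4) cb(1) cc(1) assms(7,8) J] by metis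
    \<comment> \<open>Both descriptions of \<open>J\<close> are compared on the generator
      \<open>b(\<cdot>, \<sigma> y')\<close>.\<close>
    have c: "c x' y' = \<psi> x' + b (\<tau> x') (\<sigma> y') + \<phi> y'" for x' y'
      using fun_cong[OF eq, of x' y'] by (simp add: Jf[OF kernel_section_in_Rg])
    \<comment> \<open>In this order the identity has the shape required for the transposed kernels,
      where \<open>\<sigma>\<close> and \<open>\<phi>\<close> take the roles of
      \<open>\<tau>\<close> and \<open>\<psi>\<close>.\<close>
    have c': "c x' y' = \<phi> y' + b (\<tau> x') (\<sigma> y') + \<psi> x'" for x' y'
      by (simp add: c)
    show ?thesis
      using homeomorphism_of_kernel_identity[OF assms(1,3) cb(2) cc(2) assms(7) \<tau> \<sigma> c]
        homeomorphism_of_kernel_identity[OF assms(2,4) cb(1) cc(1)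
          assms(7)[THEN fully_reduced_transpose] \<sigma> \<tau> c'] c
      by metis
  qed
  have i: "\<exists>J. maxplus_isomorphism (Rg b) (Rg c) J"
    if "\<exists>\<tau>'. homeomorphism UNIV UNIV \<tau> \<tau>'" "\<exists>\<sigma>'. homeomorphism UNIV UNIV \<sigma> \<sigma>'"
      "\<forall>x' y'. c x' y' = \<psi> x' + b (\<tau> x') (\<sigma> y') + \<phi> y'"
    for \<tau> :: "'x2 \<Rightarrow> 'x" and \<sigma> :: "'y2 \<Rightarrow> 'y" and \<psi> :: "'x2 \<Rightarrow> real" and \<phi> :: "'y2 \<Rightarrow> real"
  proof -
    have "bij \<tau>" "bij \<sigma>"
      using that(1,2) homeomorphism_imp_bij by blast+
    then show ?thesis
      using weighted_composition_isomorphism[of \<tau> \<sigma> c \<psi> b \<phi>] that(3) by blast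
  qed
  \<comment> \<open>By \<open>iv\<close> and \<open>v\<close> every isomorphism is a weighted
    composition, so the last two statements reduce to the existence of an isomorphism of the ranges
    or of the dual ranges.\<close>
  show ?thesis
  proof (intro conjI)
    show "(\<exists>J. maxplus_isomorphism (Rg b) (Rg c) J) \<longleftrightarrow>
        (\<exists>J. maxplus_isomorphism (Rg_dual b) (Rg_dual c) J)"
      by (rule maxplus_isomorphism_dual_iff)
  next
    show "(\<exists>J. maxplus_isomorphism (Rg b) (Rg c) J) \<longleftrightarrow>
      (\<exists>(\<tau> :: 'x2 \<Rightarrow> 'x) (\<sigma> :: 'y2 \<Rightarrow> 'y) (\<psi> :: 'x2 \<Rightarrow> real) (\<phi> :: 'y2 \<Rightarrow> real).
         (\<exists>\<tau>'. homeomorphism UNIV UNIV \<tau> \<tau>') \<and> (\<exists>\<sigma>'. homeomorphism UNIV UNIV \<sigma> \<sigma>') \<and>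
         continuous_on UNIV \<psi> \<and> continuous_on UNIV \<phi> \<and>
         (\<forall>x' y'. c x' y' = \<psi> x' + b (\<tau> x') (\<sigma> y') + \<phi> y'))"
      by (rule iffI; elim exE conjE) (rule iii, assumption, rule i, (rule exI, assumption)+, assumption)
  qed (use iv v maxplus_isomorphism_dual_iff[of b c] in blast)+
qed

end
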